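(* Let $\{(W^k,H^k)\}_{k\ge 0}$ be a sequence generated by the column-wise update algorithm described in the context. Then every accumulation point of $\{(W^k,H^k)\}$ is a critical point of $F$.
   Context: Setting. Let $V=[\mathbf v_1,\ldots,\mathbf v_n]\in\mathbb R^{m\times n}$ be a column stochastic matrix (entrywise nonnegative, each column summing to $1$), let $r<\min\{m,n\}$ be a positive integer, and let $s_1,s_2>0$ be prescribed integer sparsity levels. $\|\cdot\|$ is the Euclidean norm, $\|\cdot\|_F$ the Frobenius norm, $\|\cdot\|_2$ the spectral norm, $\|\mathbf x\|_0$ the number of nonzero entries. For a matrix $A$, $A(i,:)$ is its $i$-th row. Put $\mathcal P_n=\{\mathbf x\in\mathbb R^n: \mathbf x\ge 0,\ \sum_j x_j=1\}$ and $\mathcal Q_n^s=\{\mathbf x\in\mathbb R^n:\|\mathbf x\|_0\le s\}$; $\delta_{\mathcal K}$ is the indicator function ($0$ on $\mathcal K$, $+\infty$ off $\mathcal K$). For $W=[\mathbf w_1,\ldots,\mathbf w_r]\in\mathbb R^{m\times r}$ and $H=[\mathbf h_1,\ldots,\mathbf h_n]\in\mathbb R^{r\times n}$ let $$f(W,H)=f(\mathbf w_1,\ldots,\mathbf w_r,\mathbf h_1,\ldots,\mathbf h_n)=\tfrac12\|V-WH\|_F^2,$$ $$F(W,H)=f(W,H)+\sum_{i=1}^r\big(\delta_{\mathcal P_m}(\mathbf w_i)+\delta_{\mathcal Q_m^{s_1}}(\mathbf w_i)\big)+\sum_{t=1}^n\big(\delta_{\mathcal P_r}(\mathbf h_t)+\delta_{\mathcal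 Q_r^{s_2}}(\mathbf h_t)\big).$$ $\Pi_{\mathcal D}(\mathbf y)$ denotes the metric projection (a nearest point of $\mathcal D$ to $\mathbf y$); when the nearest point or an argmin is not unique, any choice is allowed. Algorithm. Choose $W^0$ with all columns in $\mathcal P_m\cap\mathcal Q_m^{s_1}$, $H^0$ with all columns in $\mathcal P_r\cap\mathcal Q_r^{s_2}$, $\delta_1>0$, $\delta_2>0$, $c\ge 1/\delta_2$. For $k=0,1,2,\ldots$: Step 1. For $i=1,\ldots,r$ in order: let $\phi_{i,k}(\mathbf w)=f(\mathbf w_1^{k+1},\ldots,\mathbf w_{i-1}^{k+1},\mathbf w,\mathbf w_{i+1}^k,\ldots,\mathbf w_r^k,H^k)$. If $\|H^k(i,:)\|=0$, set $\mathbf w_i^{k+1}=\mathbf w_i^k$. Otherwise compute $\bar{\mathbf w}_i^k=\operatorname{argmin}_{\mathbf w\in\mathcal P_m\cap\mathcal Q_m^{s_1}}\phi_{i,k}(\mathbf w)$; if $\phi_{i,k}(\mathbf w_i^k)-\phi_{i,k}(\bar{\mathbf w}_i^k)\ge\frac{\delta_1}{2}\|\mathbf w_i^k-\bar{\mathbf w}_i^k\|^2$, set $\mathbf w_i^{k+1}=\bar{\mathbf w}_i^k$; else set $\mathbf w_i^{k+1}=\Pi_{\mathcal P_m\cap\mathcal Q_m^{s_1}}(\mathbf w_i^k-\mu_{ik}\nabla\phi_{i,k}(\mathbf w_i^k))$ with $\mu_{ik}=1/(\|H^k(i,:)\|^2+\delta_1)$. Set $W^{k+1}=[\mathbf w_1^{k+1},\ldots,\mathbf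 w_r^{k+1}]$. Step 2. For $t=1,\ldots,n$: let $\psi_{t,k}(\mathbf h)=f(W^{k+1},\mathbf h_1^k,\ldots,\mathbf h_{t-1}^k,\mathbf h,\mathbf h_{t+1}^k,\ldots,\mathbf h_n^k)$, so $\nabla\psi_{t,k}(\mathbf h)=(W^{k+1})^T(W^{k+1}\mathbf h-\mathbf v_t)$. Take $\nu_{tk}=\min\{c,\ \|\nabla\psi_{t,k}(\mathbf h_t^k)\|^2/\|W^{k+1}\nabla\psi_{t,k}(\mathbf h_t^k)\|^2\}$ (equal to $c$ if the denominator is $0$) and compute $\bar{\mathbf h}_t^k=\Pi_{\mathcal P_r\cap\mathcal Q_r^{s_2}}(\mathbf h_t^k-\nu_{tk}\nabla\psi_{t,k}(\mathbf h_t^k))$. If $\psi_{t,k}(\mathbf h_t^k)-\psi_{t,k}(\bar{\mathbf h}_t^k)\ge\frac{\delta_2}{2}\|\mathbf h_t^k-\bar{\mathbf h}_t^k\|^2$, set $\mathbf h_t^{k+1}=\bar{\mathbf h}_t^k$; else redefine $\nu_{tk}=1/(\|(W^{k+1})^TW^{k+1}\|_2+\delta_2)$ and set $\mathbf h_t^{k+1}=\Pi_{\mathcal P_r\cap\mathcal Q_r^{s_2}}(\mathbf h_t^k-\nu_{tk}\nabla\psi_{t,k}(\mathbf h_t^k))$. Set $H^{k+1}=[\mathbf h_1^{k+1},\ldots,\mathbf h_n^{k+1}]$. Critical points. For a proper lower semicontinuous $h:\mathbb R^N\to(-\infty,+\infty]$, the Fréchet subdifferential at $\bar{\mathbf a}\in\operatorname{dom}h$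 is $\widehat\partial h(\bar{\mathbf a})=\{\mathbf r:\liminf_{\mathbf a\to\bar{\mathbf a}}\frac{h(\mathbf a)-h(\bar{\mathbf a})-\langle\mathbf r,\mathbf a-\bar{\mathbf a}\rangle}{\|\mathbf a-\bar{\mathbf a}\|}\ge0\}$ (empty if $\bar{\mathbf a}\notin\operatorname{dom}h$), and the limiting subdifferential is $\partial h(\bar{\mathbf a})=\{\mathbf r:\exists\,\mathbf a^k\to\bar{\mathbf a},\ h(\mathbf a^k)\to h(\bar{\mathbf a}),\ \mathbf r^k\in\widehat\partial h(\mathbf a^k),\ \mathbf r^k\to\mathbf r\}$. A point $\bar{\mathbf a}$ is a critical point of $h$ if $\mathbf 0\in\partial h(\bar{\mathbf a})$. This is applied to $F$ on $\mathbb R^{m\times r}\times\mathbb R^{r\times n}$ with the Frobenius inner product. *)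

theory Defs
  imports "HOL-Analysis.Analysis"
begin

definition column_stochastic :: "real^'n^'m \<Rightarrow> bool" where
  "column_stochastic A \<longleftrightarrow> (\<forall>i j. 0 \<le> A $ i $ j) \<and> (\<forall>j. (\<Sum>i\<in>UNIV. A $ i $ j) = 1)"

definition prob_simplex :: "(real^'d) set" where
  "prob_simplex = {x. (\<forall>j. 0 \<le> x $ j) \<and> (\<Sum>j\<in>UNIV. x $ j) = 1}"

definition l0_norm :: "real^'d \<Rightarrow> nat" where
  "l0_norm x = card {j. x $ j \<noteq> 0}"

definition sparse_set :: "nat \<Rightarrow> (real^'d) set" where
  "sparse_set s = {x. l0_norm x \<le> s}"

definition delta :: "'a set \<Rightarrow> 'a \<Rightarrow> ereal" where
  "delta K x = (if x \<in> K then 0 else \<infinity>)"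

text \<open>The norm of \<open>real^'n^'m\<close> is the Frobenius norm, and its inner product the
  Frobenius inner product.\<close>

definition nmf_loss :: "real^'n^'m \<Rightarrow> real^'r^'m \<Rightarrow> real^'n^'r \<Rightarrow> real" where
  "nmf_loss V W H = 1/2 * (norm (V - W ** H))\<^sup>2"

definition nmf_objective ::
  "real^'n^'m \<Rightarrow> nat \<Rightarrow> nat \<Rightarrow> (real^'r^'m) \<times> (real^'n^'r) \<Rightarrow> ereal" where
  "nmf_objective V s1 s2 = (\<lambda>(W, H).
     ereal (nmf_loss V W H)
     + (\<Sum>i\<in>UNIV. delta prob_simplex (column i W) + delta (sparse_set s1) (column i W))
     + (\<Sum>t\<in>UNIV. delta prob_simplex (column t H) + delta (sparse_set s2) (column t H)))"

definition is_projection :: "'a::metric_space set \<Rightarrow> 'a \<Rightarrow> 'a \<Rightarrow> bool" where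
  "is_projection D y p \<longleftrightarrow> is_arg_min (\<lambda>x. dist x y) (\<lambda>x. x \<in> D) p"

definition gradient :: "('a::real_inner \<Rightarrow> real) \<Rightarrow> 'a \<Rightarrow> 'a" where
  "gradient f x = (THE g. GDERIV f x :> g)"

definition spectral_norm :: "real^'n^'m \<Rightarrow> real" where
  "spectral_norm A = onorm (\<lambda>x. A *v x)"

definition replace_column :: "real^'n^'m \<Rightarrow> 'n \<Rightarrow> real^'m \<Rightarrow> real^'n^'m" where
  "replace_column A j x = (\<chi> a l. if l = j then x $ a else A $ a $ l)"

text \<open>\<open>phi_fun V W W' H i w\<close> is the loss at the matrix whose columns before \<open>i\<close> are the
  already updated ones (from \<open>W'\<close>), whose \<open>i\<close>-th column is \<open>w\<close>, and whose later columns come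
  from the old iterate \<open>W\<close>. The order of the column updates is the linear order of the
  type \<open>'r\<close>.\<close>

definition phi_fun ::
  "real^'n^'m \<Rightarrow> real^'r::{finite,linorder}^'m \<Rightarrow> real^'r::{finite,linorder}^'m \<Rightarrow> real^'n^'r::{finite,linorder} \<Rightarrow> 'r::{finite,linorder}
    \<Rightarrow> real^'m \<Rightarrow> real" where
  "phi_fun V W W' H i w =
     nmf_loss V (\<chi> a l. if l < i then W' $ a $ l else if l = i then w $ a else W $ a $ l) H"

definition psi_fun ::
  "real^'n^'m \<Rightarrow> real^'r^'m \<Rightarrow> real^'n^'r \<Rightarrow> 'n \<Rightarrow> real^'r \<Rightarrow> real" where
  "psi_fun V W' H t h = nmf_loss V W' (replace_column H t h)"

text \<open>The steps are relations rather than functions: where an argmin or a nearest point is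
  not unique, every choice is admitted.\<close>

definition W_step ::
  "real^'n^'m \<Rightarrow> nat \<Rightarrow> real \<Rightarrow> real^'r::{finite,linorder}^'m \<Rightarrow> real^'n^'r::{finite,linorder} \<Rightarrow> real^'r::{finite,linorder}^'m
    \<Rightarrow> 'r::{finite,linorder} \<Rightarrow> bool" where
  "W_step V s1 \<delta>1 W H W' i \<longleftrightarrow>
    (let D = prob_simplex \<inter> sparse_set s1;
         \<phi> = phi_fun V W W' H i;
         w = column i W;
         w' = column i W';
         \<mu> = 1 / ((norm (row i H))\<^sup>2 + \<delta>1)
     in if norm (row i H) = 0 then w' = w
        else (\<exists>wb. is_arg_min \<phi> (\<lambda>x. x \<in> D) wb \<and>
               (if \<phi> w - \<phi> wb \<ge> \<delta>1 / 2 * (norm (w - wb))\<^sup>2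
                then w' = wb
                else is_projection D (w - \<mu> *\<^sub>R gradient \<phi> w) w')))"

definition H_step ::
  "real^'n^'m \<Rightarrow> nat \<Rightarrow> real \<Rightarrow> real \<Rightarrow> real^'r^'m \<Rightarrow> real^'n^'r \<Rightarrow> real^'n^'r
    \<Rightarrow> 'n \<Rightarrow> bool" where
  "H_step V s2 \<delta>2 c W' H H' t \<longleftrightarrow>
    (let D = prob_simplex \<inter> sparse_set s2;
         \<psi> = psi_fun V W' H t;
         h = column t H;
         h' = column t H';
         g = gradient \<psi> h;
         \<nu> = (if norm (W' *v g) = 0 then c
              else min c ((norm g)\<^sup>2 / (norm (W' *v g))\<^sup>2));
         \<nu>' = 1 / (spectral_norm (transpose W' ** W') + \<delta>2)
     in \<exists>hb. is_projection D (h - \<nu> *\<^sub>R g) hb \<and>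
          (if \<psi> h - \<psi> hb \<ge> \<delta>2 / 2 * (norm (h - hb))\<^sup>2
           then h' = hb
           else is_projection D (h - \<nu>' *\<^sub>R g) h'))"

definition nmf_iteration ::
  "real^'n^'m \<Rightarrow> nat \<Rightarrow> nat \<Rightarrow> real \<Rightarrow> real \<Rightarrow> real
    \<Rightarrow> (nat \<Rightarrow> real^'r::{finite,linorder}^'m) \<Rightarrow> (nat \<Rightarrow> real^'n^'r::{finite,linorder}) \<Rightarrow> bool" where
  "nmf_iteration V s1 s2 \<delta>1 \<delta>2 c W H \<longleftrightarrow>
     (\<forall>i. column i (W 0) \<in> prob_simplex \<inter> sparse_set s1) \<and>
     (\<forall>t. column t (H 0) \<in> prob_simplex \<inter> sparse_set s2) \<and>
     (\<forall>k. (\<forall>i. W_step V s1 \<delta>1 (W k) (H k) (W (Suc k)) i) \<and>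
          (\<forall>t. H_step V s2 \<delta>2 c (W (Suc k)) (H k) (H (Suc k)) t))"

text \<open>In the quotient below \<open>h a\<close> is finite when \<open>h\<close> is proper, so the
  difference is never of the form \<open>\<infinity> - \<infinity>\<close>; the filter \<open>at a\<close> excludes the point \<open>a\<close>.\<close>

definition frechet_subdifferential ::
  "('a::euclidean_space \<Rightarrow> ereal) \<Rightarrow> 'a \<Rightarrow> 'a set" where
  "frechet_subdifferential h a =
     {r. h a < \<infinity> \<and>
         0 \<le> Liminf (at a) (\<lambda>x. (h x - h a - ereal (r \<bullet> (x - a))) / ereal (norm (x - a)))}"

definition limiting_subdifferential ::
  "('a::euclidean_space \<Rightarrow> ereal) \<Rightarrow> 'a \<Rightarrow> 'a set" where
  "limiting_subdifferential h a =
     {r. \<exists>x s. x \<longlonglongrightarrow> a \<and> (\<lambda>k. h (x k)) \<longlonglongrightarrow> h a \<and>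
               (\<forall>k::nat. s k \<in> frechet_subdifferential h (x k)) \<and> s \<longlonglongrightarrow> r}"

definition critical_point :: "('a::euclidean_space \<Rightarrow> ereal) \<Rightarrow> 'a \<Rightarrow> bool" where
  "critical_point h a \<longleftrightarrow> 0 \<in> limiting_subdifferential h a"

definition accumulation_point :: "(nat \<Rightarrow> 'a::topological_space) \<Rightarrow> 'a \<Rightarrow> bool" where
  "accumulation_point x l \<longleftrightarrow> (\<exists>\<sigma>::nat \<Rightarrow> nat. strict_mono \<sigma> \<and> (x \<circ> \<sigma>) \<longlonglongrightarrow> l)"

end

theory Submission
  imports Defs
begin

text \<open>Every rule of the algorithm leaves the updated column at a point of its constraint set
  where a proximal normal is the negative partial gradient of the loss plus a bounded multiple of
  the displacement of that column, and decreases the loss by at least a fixed multiple of the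
  squared displacement. Hence displacements tend to zero. Adding these normals to the gradient of
  the loss at the new iterate gives Frechet subgradients of the objective which, along any convergent
  subsequence, tend to zero; the constraint set is closed, so the objective values converge
  and zero is a limiting subgradient at the accumulation point.\<close>

subsection \<open>Proximal normals and subdifferentials\<close>

text \<open>Sparsity makes the constraint sets nonconvex, so a projection satisfies no variational
  inequality. What survives is a one-sided bound with quadratic error, and
  \<open>proximal_normal\<close> records exactly that. Its constant \<open>K\<close> may change from
  point to point: a quadratic error disappears in the difference quotient at each fixed iterate, so
  only the normals themselves have to converge. The partial gradients supplied by the updates sit at
  stale arguments: a half-swept matrix for a column of \<open>W\<close>, the previous
  \<open>H\<close> for a column of \<open>H\<close>. They do not cancel the gradient at the new
  iterate exactly, but vanishing displacements send all these arguments to one limit, where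
  continuity makes them cancel. The loss is quadratic in each factor separately, so exact
  second-order expansions do the work of descent and Lipschitz estimates.\<close>

definition proximal_normal :: "'a::real_inner set \<Rightarrow> 'a \<Rightarrow> 'a \<Rightarrow> bool" where
  "proximal_normal D p \<nu> \<longleftrightarrow> (\<exists>K\<ge>0. \<forall>x\<in>D. \<nu> \<bullet> (x - p) \<le> K * (norm (x - p))\<^sup>2)"

lemma proximal_normal_zero: "proximal_normal D p 0"
  unfolding proximal_normal_def by (rule exI[of _ 0]) simp

text \<open>Expanding the square of the nearest-point inequality around \<open>p\<close> leaves
  \<open>norm (x - p)\<close> squared as a bound for twice the inner product; no convexity of
  \<open>D\<close> enters.\<close>

lemma proximal_normal_projection:
  fixes y p :: "'a::real_inner"
  assumes "is_projection D y p" and "\<rho> \<ge> 0"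
  shows "proximal_normal D p (\<rho> *\<^sub>R (y - p))"
  unfolding proximal_normal_def
proof (intro exI[of _ "\<rho>/2"] conjI ballI)
  fix x assume "x \<in> D"
  with assms(1) have "dist p y \<le> dist x y"
    by (auto simp: is_projection_def is_arg_min_def not_less)
  then have "(norm (p - y))\<^sup>2 \<le> (norm ((x - p) + (p - y)))\<^sup>2"
    by (auto simp: dist_norm intro: power_mono)
  then have "2 * ((y - p) \<bullet> (x - p)) \<le> (norm (x - p))\<^sup>2"
    unfolding power2_norm_eq_inner by (simp add: inner_simps inner_commute)
  from mult_left_mono[OF this assms(2)]
  show "\<rho> *\<^sub>R (y - p) \<bullet> (x - p) \<le> \<rho> / 2 * (norm (x - p))\<^sup>2"
    by simp
qed (use assms in simp)

text \<open>Minimality makes the linear term plus the remainder nonnegative on \<open>D\<close>, so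
  the negative gradient exceeds the remainder nowhere, and the remainder is at most
  quadratic.\<close>

lemma proximal_normal_arg_min:
  fixes p :: "'a::real_inner"
  assumes "is_arg_min \<phi> (\<lambda>x. x \<in> D) p"
    and "\<And>x. \<phi> x = \<phi> p + g \<bullet> (x - p) + Q (x - p)"
    and "\<And>d. Q d \<le> L / 2 * (norm d)\<^sup>2" and "L \<ge> 0"
  shows "proximal_normal D p (- g)"
  unfolding proximal_normal_def
proof (intro exI[of _ "L/2"] conjI ballI)
  fix x assume "x \<in> D"
  with assms(1) have "\<phi> p \<le> \<phi> x"
    by (auto simp: is_arg_min_def not_less)
  then show "- g \<bullet> (x - p) \<le> L / 2 * (norm (x - p))\<^sup>2"
    using assms(2)[of x] assms(3)[of "x - p"] by simp
qed (use assms in simp)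

text \<open>The old point \<open>w\<close> is itself a competitor in the projection. Comparing with
  it bounds the linear term by minus half of \<open>L + \<delta>\<close> times the squared
  displacement; the curvature gives back at most \<open>L / 2\<close>, and
  \<open>\<delta> / 2\<close> remains.\<close>

lemma projection_sufficient_decrease:
  fixes w p :: "'a::real_inner"
  assumes proj: "is_projection D (w - (1 / (L + \<delta>)) *\<^sub>R g) p" and "w \<in> D"
    and expand: "\<phi> p = \<phi> w + g \<bullet> (p - w) + Q (p - w)"
    and Q: "Q (p - w) \<le> L / 2 * (norm (p - w))\<^sup>2" and L: "L \<ge> 0" "\<delta> > 0"
  shows "\<phi> w - \<phi> p \<ge> \<delta> / 2 * (norm (w - p))\<^sup>2"
proof -
  define \<mu> where "\<mu> = 1 / (L + \<delta>)"
  have "dist p (w - \<mu> *\<^sub>R g) \<le> dist w (w - \<mu> *\<^sub>R g)"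
    using proj \<open>w \<in> D\<close> by (auto simp: is_projection_def is_arg_min_def not_less \<mu>_def)
  then have "(norm ((p - w) + \<mu> *\<^sub>R g))\<^sup>2 \<le> (norm (\<mu> *\<^sub>R g))\<^sup>2"
    by (intro power_mono) (auto simp: dist_norm algebra_simps)
  then have "(norm (p - w))\<^sup>2 + 2 * \<mu> * (g \<bullet> (p - w)) \<le> 0"
    unfolding power2_norm_eq_inner by (simp add: inner_simps inner_commute algebra_simps)
  then have "(L + \<delta>) * ((norm (p - w))\<^sup>2 + 2 * \<mu> * (g \<bullet> (p - w))) \<le> 0"
    using L by (intro mult_nonneg_nonpos) auto
  moreover have "(L + \<delta>) * \<mu> = 1" using L by (simp add: \<mu>_def)
  moreover have "(L + \<delta>) * ((norm (p - w))\<^sup>2 + 2 * \<mu> * (g \<bullet> (p - w)))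
      = (L + \<delta>) * (norm (p - w))\<^sup>2 + ((L + \<delta>) * \<mu>) * (2 * (g \<bullet> (p - w)))"
    by (simp add: algebra_simps)
  ultimately have "(L + \<delta>) * (norm (p - w))\<^sup>2 + 2 * (g \<bullet> (p - w)) \<le> 0"
    by simp
  then show ?thesis
    using Q expand by (simp add: norm_minus_commute[of w p] algebra_simps)
qed

lemma gradient_eqI:
  fixes \<phi> :: "'a::real_inner \<Rightarrow> real"
  assumes expand: "\<And>x. \<phi> x = \<phi> y + g \<bullet> (x - y) + Q (x - y)"
    and Q: "\<And>d. \<bar>Q d\<bar> \<le> K * (norm d)\<^sup>2"
  shows "gradient \<phi> y = g"
proof -
  have "((\<lambda>x. norm (\<phi> x - \<phi> y - g \<bullet> (x - y)) / norm (x - y)) \<longlongrightarrow> 0) (at y)"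
  proof (rule Lim_null_comparison)
    show "\<forall>\<^sub>F x in at y. norm (norm (\<phi> x - \<phi> y - g \<bullet> (x - y)) / norm (x - y)) \<le> \<bar>K\<bar> * norm (x - y)"
    proof (intro always_eventually allI)
      fix x
      have "\<bar>Q (x - y)\<bar> \<le> \<bar>K\<bar> * (norm (x - y))\<^sup>2"
        using Q[of "x - y"] by (meson abs_ge_self mult_right_mono order_trans zero_le_power2)
      then show "norm (norm (\<phi> x - \<phi> y - g \<bullet> (x - y)) / norm (x - y)) \<le> \<bar>K\<bar> * norm (x - y)"
        using expand[of x] by (cases "x = y") (auto simp: field_simps power2_eq_square)
    qed
    show "((\<lambda>x. \<bar>K\<bar> * norm (x - y)) \<longlongrightarrow> 0) (at y)"
      by (auto intro!: tendsto_eq_intros)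
  qed
  then have "GDERIV \<phi> y :> g"
    unfolding gderiv_def has_derivative_iff_norm
    by (simp add: inner_commute bounded_linear_inner_left)
  \<comment> \<open>\<open>gradient\<close> is a definite description, so uniqueness has to be
    supplied along with existence.\<close>
  moreover have "g' = g" if "GDERIV \<phi> y :> g'" for g'
  proof -
    have "(\<lambda>h. h \<bullet> g') = (\<lambda>h. h \<bullet> g)"
      using that \<open>GDERIV \<phi> y :> g\<close> unfolding gderiv_def by (rule has_derivative_unique)
    then show ?thesis by (metis inner_commute vector_eq_rdot)
  qed
  ultimately show ?thesis unfolding gradient_def by (rule the_equality)
qed

text \<open>A proximal normal is a Frechet normal: dividing its quadratic error by
  \<open>norm (x - a)\<close> leaves a term that vanishes at \<open>a\<close>. Off \<open>C\<close>
  the quotient is infinite and imposes nothing.\<close>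

lemma frechet_subdifferentialI:
  fixes a :: "'a::euclidean_space"
  assumes deriv: "GDERIV f a :> g" and "a \<in> C" and "proximal_normal C a \<nu>"
    and F: "\<And>x. F x = (if x \<in> C then ereal (f x) else \<infinity>)"
  shows "g + \<nu> \<in> frechet_subdifferential F a"
proof -
  obtain K where K: "K \<ge> 0" "\<And>x. x \<in> C \<Longrightarrow> \<nu> \<bullet> (x - a) \<le> K * (norm (x - a))\<^sup>2"
    using assms(3) unfolding proximal_normal_def by auto
  have lim: "((\<lambda>x. norm (f x - f a - (x - a) \<bullet> g) / norm (x - a)) \<longlongrightarrow> 0) (at a)"
    using deriv unfolding gderiv_def has_derivative_iff_norm by auto
  \<comment> \<open>A real minorant of the difference quotient: the first term is the
    differentiation error of \<open>f\<close>, the second the error of the proximal normal.\<close>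
  define u where "u x = - (norm (f x - f a - (x - a) \<bullet> g) / norm (x - a)) - K * norm (x - a)" for x
  have "((\<lambda>x. K * norm (x - a)) \<longlongrightarrow> 0) (at a)"
    by (auto intro!: tendsto_eq_intros)
  from tendsto_diff[OF tendsto_minus[OF lim] this]
  have "((\<lambda>x. ereal (u x)) \<longlongrightarrow> ereal 0) (at a)"
    unfolding u_def by (intro tendsto_ereal) simp
  then have "Liminf (at a) (\<lambda>x. ereal (u x)) = 0"
    by (subst lim_imp_Liminf[of _ _ 0]) (auto simp: zero_ereal_def)
  moreover have "Liminf (at a) (\<lambda>x. ereal (u x))
      \<le> Liminf (at a) (\<lambda>x. (F x - F a - ereal ((g + \<nu>) \<bullet> (x - a))) / ereal (norm (x - a)))"
  proof (rule Liminf_mono, unfold eventually_at_filter, intro always_eventually allI impI)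
    fix x assume "x \<noteq> a"
    then have n: "norm (x - a) > 0" by simp
    show "ereal (u x) \<le> (F x - F a - ereal ((g + \<nu>) \<bullet> (x - a))) / ereal (norm (x - a))"
    proof (cases "x \<in> C")
      case True
      have "u x * norm (x - a) = - norm (f x - f a - (x - a) \<bullet> g) - K * (norm (x - a))\<^sup>2"
        using n by (simp add: u_def left_diff_distrib power2_eq_square)
      also have "\<dots> \<le> f x - f a - (g + \<nu>) \<bullet> (x - a)"
        using K(2)[OF True] by (simp add: inner_simps inner_commute abs_if split: if_splits)
      finally have "u x \<le> (f x - f a - (g + \<nu>) \<bullet> (x - a)) / norm (x - a)"
        using n by (simp add: field_simps)
      then show ?thesis using True \<open>a \<in> C\<close> n by (simp add: F)
    next
      case False
      then show ?thesis using \<open>a \<in> C\<close> n by (simp add: F)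
    qed
  qed
  ultimately show ?thesis
    unfolding frechet_subdifferential_def using \<open>a \<in> C\<close> by (auto simp: F)
qed

section \<open>Closedness of the constraints and the effective domain of the objective\<close>

lemma closed_prob_simplex: "closed (prob_simplex :: (real^'d) set)"
proof -
  have "prob_simplex = (\<Inter>j. {x::real^'d. 0 \<le> x $ j}) \<inter> {x. (\<Sum>j\<in>UNIV. x $ j) = 1}"
    unfolding prob_simplex_def by auto
  also have "closed \<dots>"
    by (intro closed_Int closed_INT ballI closed_Collect_le closed_Collect_eq continuous_intros)
  finally show ?thesis .
qed

lemma closed_sparse_set: "closed (sparse_set s :: (real^'d) set)"
proof -
  \<comment> \<open>A finite union of coordinate subspaces, one for each admissible support
    \<open>S\<close>; finiteness of the index type keeps the union closed.\<close>
  have "sparse_set s = (\<Union>S\<in>{S. card S \<le> s}. \<Inter>j\<in>-S. {x::real^'d. x $ j = 0})" (is "_ = ?R")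
  proof (intro set_eqI iffI)
    fix x :: "real^'d" assume "x \<in> sparse_set s"
    then have "card {j. x $ j \<noteq> 0} \<le> s" by (simp add: sparse_set_def l0_norm_def)
    then show "x \<in> ?R" by (intro UN_I[of "{j. x $ j \<noteq> 0}"]) auto
  next
    fix x :: "real^'d" assume "x \<in> ?R"
    then obtain S where S: "card S \<le> s" "\<And>j. j \<notin> S \<Longrightarrow> x $ j = 0" by auto
    then have "{j. x $ j \<noteq> 0} \<subseteq> S" by auto
    then have "card {j. x $ j \<noteq> 0} \<le> card S" by (intro card_mono) auto
    with S(1) show "x \<in> sparse_set s" by (simp add: sparse_set_def l0_norm_def)
  qed
  also have "closed \<dots>"
    by (intro closed_UN closed_INT ballI closed_Collect_eq continuous_intros) auto
  finally show ?thesis .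
qed

definition nmf_feasible :: "nat \<Rightarrow> nat \<Rightarrow> ((real^'r^'m) \<times> (real^'n^'r)) set" where
  "nmf_feasible s1 s2 = {x. (\<forall>i. column i (fst x) \<in> prob_simplex \<inter> sparse_set s1) \<and>
     (\<forall>t. column t (snd x) \<in> prob_simplex \<inter> sparse_set s2)}"

lemma sum_delta_delta:
  fixes f :: "'i::finite \<Rightarrow> 'a"
  shows "(\<Sum>i\<in>UNIV. delta A (f i) + delta B (f i)) = (if \<forall>i. f i \<in> A \<inter> B then 0 else \<infinity>)"
proof (cases "\<forall>i. f i \<in> A \<inter> B")
  case True
  then show ?thesis by (auto simp: delta_def)
next
  case False
  then obtain i where "f i \<notin> A \<inter> B" by blast
  then have "delta A (f i) + delta B (f i) = \<infinity>" by (auto simp: delta_def)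
  then have "(\<Sum>i\<in>UNIV. delta A (f i) + delta B (f i)) = \<infinity>"
    by (subst sum_Pinfty) auto
  with False show ?thesis by auto
qed

lemma nmf_objective_eq:
  "nmf_objective V s1 s2 x =
    (if x \<in> nmf_feasible s1 s2 then ereal (nmf_loss V (fst x) (snd x)) else \<infinity>)"
  by (cases x) (simp add: nmf_objective_def sum_delta_delta nmf_feasible_def)

lemma tendsto_column: "(X \<longlongrightarrow> A) F \<Longrightarrow> ((\<lambda>k. column j (X k)) \<longlongrightarrow> column j A) F"
  unfolding column_def by (intro tendsto_vec_lambda tendsto_vec_nth)

lemma closed_nmf_feasible:
  "closed (nmf_feasible s1 s2 :: ((real^'r^'m) \<times> (real^'n^'r)) set)"
  unfolding closed_sequential_limits
proof (intro allI impI, elim conjE)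
  fix x :: "nat \<Rightarrow> (real^'r^'m) \<times> (real^'n^'r)" and l
  assume x: "\<forall>k. x k \<in> nmf_feasible s1 s2" and l: "x \<longlonglongrightarrow> l"
  have "column i (fst l) \<in> prob_simplex \<inter> sparse_set s1" for i
    using x by (intro closed_sequentially[OF _ _ tendsto_column[OF tendsto_fst[OF l]]]
        closed_Int closed_prob_simplex closed_sparse_set) (auto simp: nmf_feasible_def)
  moreover have "column t (snd l) \<in> prob_simplex \<inter> sparse_set s2" for t
    using x by (intro closed_sequentially[OF _ _ tendsto_column[OF tendsto_snd[OF l]]]
        closed_Int closed_prob_simplex closed_sparse_set) (auto simp: nmf_feasible_def)
  ultimately show "l \<in> nmf_feasible s1 s2" by (auto simp: nmf_feasible_def)
qed

subsection \<open>The quadratic loss\<close>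

lemma inner_eq_sum_columns:
  fixes A B :: "real^'n^'m"
  shows "A \<bullet> B = (\<Sum>j\<in>UNIV. column j A \<bullet> column j B)"
  by (simp add: inner_vec_def column_def) (rule sum.swap)

lemma norm_eq_sum_columns:
  fixes A :: "real^'n^'m"
  shows "(norm A)\<^sup>2 = (\<Sum>j\<in>UNIV. (norm (column j A))\<^sup>2)"
  by (simp only: power2_norm_eq_inner inner_eq_sum_columns)

lemma column_diff: "column j (A - B) = column j A - column j (B :: real^'n^'m)"
  by (simp add: column_def vec_eq_iff)

lemma column_matrix_matrix_mult:
  fixes A :: "real^'r^'m" and B :: "real^'n^'r"
  shows "column j (A ** B) = A *v column j B"
  by (simp add: column_def matrix_matrix_mult_def matrix_vector_mult_def vec_eq_iff)

lemma inner_matrix_mult_left: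
  fixes A :: "real^'n^'m" and W :: "real^'r^'m" and E :: "real^'n^'r"
  shows "(transpose W ** A) \<bullet> E = A \<bullet> (W ** E)"
  unfolding inner_eq_sum_columns column_matrix_matrix_mult
  by (simp add: dot_lmul_matrix)

text \<open>The adjoint of right multiplication by \<open>H\<close>. This map mixes columns, so,
  unlike its left-hand counterpart, it is not settled column by column but by exchanging sums over
  entries.\<close>

lemma inner_matrix_mult_right:
  fixes A :: "real^'n^'m" and D :: "real^'r^'m" and H :: "real^'n^'r"
  shows "(A ** transpose H) \<bullet> D = A \<bullet> (D ** H)"
proof -
  have "(A ** transpose H) \<bullet> D = (\<Sum>a\<in>UNIV. \<Sum>l\<in>UNIV. \<Sum>j\<in>UNIV. A $ a $ j * H $ l $ j * D $ a $ l)"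
    by (simp add: inner_vec_def matrix_matrix_mult_def transpose_def sum_distrib_right)
  also have "\<dots> = (\<Sum>a\<in>UNIV. \<Sum>j\<in>UNIV. \<Sum>l\<in>UNIV. A $ a $ j * H $ l $ j * D $ a $ l)"
    by (intro sum.cong refl sum.swap)
  also have "\<dots> = A \<bullet> (D ** H)"
    by (simp add: inner_vec_def matrix_matrix_mult_def sum_distrib_left ac_simps)
  finally show ?thesis .
qed

lemma bounded_bilinear_matrix_matrix_mult:
  "bounded_bilinear ((**) :: real^'r^'m \<Rightarrow> real^'n^'r \<Rightarrow> real^'n^'m)"
  unfolding bilinear_conv_bounded_bilinear[symmetric] bilinear_def
  by (auto intro!: linearI simp: matrix_add_ldistrib matrix_matrix_mult_def vec_eq_iff
      sum.distrib sum_distrib_left algebra_simps)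

lemmas tendsto_matrix_matrix_mult =
  bounded_bilinear.tendsto[OF bounded_bilinear_matrix_matrix_mult]

lemma norm_matrix_vector_mult_le:
  fixes A :: "real^'n^'m"
  shows "norm (A *v x) \<le> norm A * norm x"
proof -
  have "norm (A *v x) = L2_set (\<lambda>i. norm (A $ i \<bullet> x)) UNIV"
    by (simp add: norm_vec_def matrix_vector_mul_component)
  also have "\<dots> \<le> L2_set (\<lambda>i. norm (A $ i) * norm x) UNIV"
    by (intro L2_set_mono) (auto simp: Cauchy_Schwarz_ineq2)
  also have "\<dots> = norm A * norm x"
    by (simp add: norm_vec_def L2_set_left_distrib)
  finally show ?thesis .
qed

lemma spectral_norm_le: "spectral_norm A \<le> norm (A :: real^'n^'m)"
  unfolding spectral_norm_def by (rule onorm_bound) (auto simp: norm_matrix_vector_mult_le)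

lemma spectral_norm_nonneg: "0 \<le> spectral_norm (A :: real^'n^'m)"
  unfolding spectral_norm_def by (rule onorm_pos_le) (rule matrix_vector_mul_bounded_linear)

text \<open>The left side is the quadratic form of the Gram matrix of \<open>W\<close>. This is the
  curvature bound behind the fallback step length of the \<open>H\<close> update.\<close>

lemma norm_matrix_vector_mult_le_spectral:
  fixes W :: "real^'r^'m"
  shows "(norm (W *v d))\<^sup>2 \<le> spectral_norm (transpose W ** W) * (norm d)\<^sup>2"
proof -
  have "(norm (W *v d))\<^sup>2 = ((transpose W ** W) *v d) \<bullet> d"
    by (simp add: power2_norm_eq_inner dot_lmul_matrix matrix_vector_mul_assoc[symmetric])
  also have "\<dots> \<le> norm ((transpose W ** W) *v d) * norm d"
    by (rule norm_cauchy_schwarz)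
  also have "\<dots> \<le> (spectral_norm (transpose W ** W) * norm d) * norm d"
    unfolding spectral_norm_def
    by (intro mult_right_mono onorm matrix_vector_mul_bounded_linear) auto
  finally show ?thesis by (simp add: power2_eq_square mult.assoc)
qed

section \<open>Single-column perturbations and the expansion of the loss\<close>

definition column_matrix :: "'n \<Rightarrow> real^'m \<Rightarrow> real^'n^'m" where
  "column_matrix j d = (\<chi> a l. if l = j then d $ a else 0)"

lemma column_column_matrix: "column l (column_matrix j d) = (if l = j then d else 0)"
  by (simp add: column_matrix_def column_def vec_eq_iff)

lemma inner_column_matrix:
  fixes A :: "real^'n^'m"
  shows "A \<bullet> column_matrix j d = column j A \<bullet> d"
proof -
  have "A \<bullet> column_matrix j d = (\<Sum>l\<in>UNIV. if l = j then column l A \<bullet> d else 0)"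
    unfolding inner_eq_sum_columns column_column_matrix by (intro sum.cong) auto
  then show ?thesis by simp
qed

lemma norm_matrix_mult_column_matrix:
  fixes W :: "real^'r^'m"
  shows "(norm (W ** column_matrix j d :: real^'n^'m))\<^sup>2 = (norm (W *v d))\<^sup>2"
proof -
  have "(norm (W ** column_matrix j d :: real^'n^'m))\<^sup>2
      = (\<Sum>l\<in>UNIV. if l = j then (norm (W *v d))\<^sup>2 else 0)"
    unfolding norm_eq_sum_columns column_matrix_matrix_mult column_column_matrix
    by (intro sum.cong) auto
  then show ?thesis by simp
qed

text \<open>The product is the outer product of \<open>d\<close> with row \<open>j\<close> of
  \<open>H\<close>. Hence the squared row norm is the curvature of the loss in a single column of
  \<open>W\<close>, which explains the step length of the \<open>W\<close> update.\<close>

lemma norm_column_matrix_mult: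
  fixes H :: "real^'n^'r" and d :: "real^'m"
  shows "(norm (column_matrix j d ** H))\<^sup>2 = (norm (row j H))\<^sup>2 * (norm d)\<^sup>2"
proof -
  have "column t (column_matrix j d ** H) = (row j H $ t) *\<^sub>R d" for t
    by (simp add: column_matrix_def column_def row_def matrix_matrix_mult_def vec_eq_iff
        if_distrib[of "(*) _"] mult.commute cong: if_cong)
  then have "(norm (column_matrix j d ** H))\<^sup>2 = (\<Sum>t\<in>UNIV. (row j H $ t)\<^sup>2 * (norm d)\<^sup>2)"
    unfolding norm_eq_sum_columns by (simp add: power_mult_distrib)
  also have "\<dots> = (norm (row j H))\<^sup>2 * (norm d)\<^sup>2"
    unfolding sum_distrib_right[symmetric] power2_norm_eq_inner[of "row j H"]
    by (simp add: inner_vec_def power2_eq_square)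
  finally show ?thesis .
qed

lemma nmf_loss_add_left:
  fixes V :: "real^'n^'m" and W D :: "real^'r^'m" and H :: "real^'n^'r"
  shows "nmf_loss V (W + D) H =
    nmf_loss V W H + ((W ** H - V) ** transpose H) \<bullet> D + 1/2 * (norm (D ** H))\<^sup>2"
proof -
  have *: "V - (W + D) ** H = (V - W ** H) - D ** H"
    by (simp add: bounded_bilinear.add_left[OF bounded_bilinear_matrix_matrix_mult])
  show ?thesis
    unfolding nmf_loss_def inner_matrix_mult_right * power2_norm_eq_inner
    by (simp add: inner_simps inner_commute algebra_simps)
qed

lemma nmf_loss_add_right:
  fixes V :: "real^'n^'m" and W :: "real^'r^'m" and H E :: "real^'n^'r"
  shows "nmf_loss V W (H + E) =
    nmf_loss V W H + (transpose W ** (W ** H - V)) \<bullet> E + 1/2 * (norm (W ** E))\<^sup>2"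
proof -
  have *: "V - W ** (H + E) = (V - W ** H) - W ** E"
    by (simp add: matrix_add_ldistrib)
  show ?thesis
    unfolding nmf_loss_def inner_matrix_mult_left * power2_norm_eq_inner
    by (simp add: inner_simps inner_commute algebra_simps)
qed

lemma GDERIV_nmf_loss:
  fixes V :: "real^'n^'m" and W :: "real^'r^'m" and H :: "real^'n^'r"
  shows "GDERIV (\<lambda>x. nmf_loss V (fst x) (snd x)) (W, H) :>
    ((W ** H - V) ** transpose H, transpose W ** (W ** H - V))"
proof -
  have *: "((\<lambda>x. 1/2 * ((V - fst x ** snd x) \<bullet> (V - fst x ** snd x))) has_derivative
     (\<lambda>h. 1/2 * ((V - W ** H) \<bullet> (0 - (W ** snd h + fst h ** H))
        + (0 - (W ** snd h + fst h ** H)) \<bullet> (V - W ** H)))) (at (W, H))"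
    by (rule has_derivative_eq_rhs)
      (auto intro!: derivative_eq_intros bounded_bilinear.FDERIV[OF bounded_bilinear_matrix_matrix_mult])
  define B where "B = W ** H - V"
  have "1/2 * ((V - W ** H) \<bullet> (0 - (W ** E + D ** H)) + (0 - (W ** E + D ** H)) \<bullet> (V - W ** H))
      = (D, E) \<bullet> (B ** transpose H, transpose W ** B)" for D E
  proof -
    have "V - W ** H = - B" by (simp add: B_def)
    moreover have "D \<bullet> (B ** transpose H) = B \<bullet> (D ** H)" "E \<bullet> (transpose W ** B) = B \<bullet> (W ** E)"
      by (metis inner_commute inner_matrix_mult_right) (metis inner_commute inner_matrix_mult_left)
    ultimately show ?thesis
      by (simp add: inner_simps inner_commute)
  qed
  then show ?thesis
    unfolding gderiv_def nmf_loss_def power2_norm_eq_inner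
    by (intro has_derivative_eq_rhs[OF *]) (auto simp: fun_eq_iff B_def)
qed

subsection \<open>The column updates\<close>

lemma proximal_normal_Times:
  assumes "proximal_normal A p \<mu>" and "proximal_normal B q \<nu>"
  shows "proximal_normal (A \<times> B) (p, q) (\<mu>, \<nu>)"
proof -
  obtain K L where K: "K \<ge> 0" "\<And>x. x \<in> A \<Longrightarrow> \<mu> \<bullet> (x - p) \<le> K * (norm (x - p))\<^sup>2"
    and L: "L \<ge> 0" "\<And>x. x \<in> B \<Longrightarrow> \<nu> \<bullet> (x - q) \<le> L * (norm (x - q))\<^sup>2"
    using assms unfolding proximal_normal_def by blast
  have "(\<mu>, \<nu>) \<bullet> (z - (p, q)) \<le> (K + L) * (norm (z - (p, q)))\<^sup>2" if "z \<in> A \<times> B" for z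
  proof -
    have n: "(norm (fst z - p))\<^sup>2 \<le> (norm (z - (p, q)))\<^sup>2" "(norm (snd z - q))\<^sup>2 \<le> (norm (z - (p, q)))\<^sup>2"
      using norm_fst_le[of "fst z - p" "snd z - q"] norm_snd_le[of "snd z - q" "fst z - p"]
      by (cases z; simp add: power_mono)+
    have "(\<mu>, \<nu>) \<bullet> (z - (p, q)) = \<mu> \<bullet> (fst z - p) + \<nu> \<bullet> (snd z - q)"
      by (cases z) simp
    also have "\<dots> \<le> K * (norm (fst z - p))\<^sup>2 + L * (norm (snd z - q))\<^sup>2"
      using that by (intro add_mono K L) auto
    also have "\<dots> \<le> K * (norm (z - (p, q)))\<^sup>2 + L * (norm (z - (p, q)))\<^sup>2"
      using n K(1) L(1) by (intro add_mono mult_left_mono) auto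
    finally show ?thesis by (simp add: distrib_right)
  qed
  then show ?thesis unfolding proximal_normal_def using K(1) L(1)
    by (intro exI[of _ "K + L"]) auto
qed

text \<open>The constraint is a product over columns and the Frobenius inner product splits
  accordingly; the constants of the columns add up.\<close>

lemma proximal_normal_columns:
  fixes P N :: "real^'n^'m"
  assumes "\<And>j. proximal_normal D (column j P) (column j N)"
  shows "proximal_normal {A. \<forall>j. column j A \<in> D} P N"
proof -
  have "\<forall>j. \<exists>K\<ge>0. \<forall>x\<in>D. column j N \<bullet> (x - column j P) \<le> K * (norm (x - column j P))\<^sup>2"
    using assms unfolding proximal_normal_def by blast
  then obtain K where K: "\<And>j. K j \<ge> 0"
    "\<And>j x. x \<in> D \<Longrightarrow> column j N \<bullet> (x - column j P) \<le> K j * (norm (x - column j P))\<^sup>2"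
    by metis
  have "N \<bullet> (A - P) \<le> (\<Sum>j\<in>UNIV. K j) * (norm (A - P))\<^sup>2" if "\<forall>j. column j A \<in> D" for A
  proof -
    have "N \<bullet> (A - P) \<le> (\<Sum>j\<in>UNIV. K j * (norm (column j (A - P)))\<^sup>2)"
      unfolding inner_eq_sum_columns column_diff using that by (intro sum_mono K) auto
    also have "\<dots> \<le> (\<Sum>j\<in>UNIV. K j * (norm (A - P))\<^sup>2)"
      by (intro sum_mono mult_left_mono K)
        (auto simp: norm_eq_sum_columns[of "A - P"] intro: member_le_sum)
    finally show ?thesis by (simp add: sum_distrib_right)
  qed
  then show ?thesis unfolding proximal_normal_def
    by (intro exI[of _ "\<Sum>j\<in>UNIV. K j"]) (auto intro: sum_nonneg K)
qed

text \<open>The state of the sweep over the columns when column \<open>i\<close> is being chosen,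
  that is, the matrix inside \<open>phi_fun\<close>, named so that gradients can be evaluated
  there.\<close>

definition partial_update ::
  "real^'r::{finite,linorder}^'m \<Rightarrow> real^'r::{finite,linorder}^'m \<Rightarrow> 'r::{finite,linorder} \<Rightarrow> real^'m
    \<Rightarrow> real^'r::{finite,linorder}^'m" where
  "partial_update W W' i x =
    (\<chi> a l. if l < i then W' $ a $ l else if l = i then x $ a else W $ a $ l)"

lemma partial_update_eq_add:
  "partial_update W W' i x = partial_update W W' i y + column_matrix i (x - y)"
  by (auto simp: partial_update_def column_matrix_def vec_eq_iff)

lemma phi_fun_expand:
  "phi_fun V W W' H i x = phi_fun V W W' H i y
    + column i ((partial_update W W' i y ** H - V) ** transpose H) \<bullet> (x - y)
    + 1/2 * (norm (row i H))\<^sup>2 * (norm (x - y))\<^sup>2"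
proof -
  have eq: "phi_fun V W W' H i z = nmf_loss V (partial_update W W' i z) H" for z
    by (simp add: phi_fun_def partial_update_def)
  show ?thesis
    unfolding eq partial_update_eq_add[of W W' i x y] nmf_loss_add_left inner_column_matrix
      norm_column_matrix_mult by simp
qed

lemma psi_fun_expand:
  "psi_fun V W H t x = psi_fun V W H t (column t H)
    + column t (transpose W ** (W ** H - V)) \<bullet> (x - column t H)
    + 1/2 * (norm (W *v (x - column t H)))\<^sup>2"
proof -
  have "replace_column H t x = H + column_matrix t (x - column t H)"
    by (auto simp: replace_column_def column_matrix_def column_def vec_eq_iff)
  moreover have "replace_column H t (column t H) = H"
    by (auto simp: replace_column_def column_def vec_eq_iff)
  ultimately show ?thesis
    by (simp add: psi_fun_def nmf_loss_add_right inner_column_matrix norm_matrix_mult_column_matrix)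
qed

text \<open>The Hessian in one column is a multiple of the identity. Expanding the value at
  \<open>x + z\<close> once around \<open>x\<close> and once around \<open>y\<close> and comparing
  the terms in \<open>z\<close> gives the claim without matrix algebra.\<close>

lemma phi_fun_gradient_diff:
  fixes H :: "real^'n^'r::{finite,linorder}"
  shows "column i ((partial_update W W' i x ** H - V) ** transpose H) =
    column i ((partial_update W W' i y ** H - V) ** transpose H) + (norm (row i H))\<^sup>2 *\<^sub>R (x - y)"
proof (rule vector_eq_rdot[THEN iffD1], rule allI)
  fix z
  let ?G = "\<lambda>x. column i ((partial_update W W' i x ** H - V) ** transpose H)"
  let ?f = "phi_fun V W W' H i"
  define N where "N = (norm (row i H))\<^sup>2"
  note expand = phi_fun_expand[of V W W' H i, folded N_def]
  have n: "(norm (x - y + z))\<^sup>2 = (norm (x - y))\<^sup>2 + 2 * ((x - y) \<bullet> z) + (norm z)\<^sup>2"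
    unfolding power2_norm_eq_inner by (simp add: inner_add_left inner_add_right inner_commute)
  have "x + z - y = x - y + z" by simp
  then have "?f (x + z) = ?f y + ?G y \<bullet> (x - y) + ?G y \<bullet> z + 1/2 * N * (norm (x - y))\<^sup>2
      + N * ((x - y) \<bullet> z) + 1/2 * N * (norm z)\<^sup>2"
    using expand[of "x + z" y] by (simp only: n inner_add_right) (simp add: distrib_left)
  moreover have "?f (x + z) = ?f x + ?G x \<bullet> z + 1/2 * N * (norm z)\<^sup>2"
    using expand[of "x + z" x] by simp
  ultimately have "?G x \<bullet> z = ?G y \<bullet> z + N * ((x - y) \<bullet> z)"
    using expand[of x y] by linarith
  then show "?G x \<bullet> z = (?G y + (norm (row i H))\<^sup>2 *\<^sub>R (x - y)) \<bullet> z"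
    by (simp add: inner_add_left N_def)
qed

text \<open>The residual of the projection, scaled by the inverse step length so that the gradient
  appears with coefficient -1.\<close>

lemma proximal_normal_gradient_projection:
  assumes "is_projection D (h - \<nu> *\<^sub>R g) p" and "\<nu> > 0"
  shows "proximal_normal D p ((1 / \<nu>) *\<^sub>R (h - p) - g)"
proof -
  have "(1 / \<nu>) *\<^sub>R (h - \<nu> *\<^sub>R g - p) = (1 / \<nu>) *\<^sub>R (h - p) - g"
    using assms(2) by (simp add: algebra_simps)
  then show ?thesis
    using proximal_normal_projection[OF assms(1), of "1 / \<nu>"] assms(2) by simp
qed

text \<open>Rewriting the gradient at the old column as the one at the new column costs exactly
  \<open>L *\<^sub>R (w - p)\<close>, so of the inverse step length \<open>L + \<delta>1\<close> only \<open>\<delta>1\<close> remains.\<close>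

lemma W_step_properties:
  fixes W W' :: "real^'r::{finite,linorder}^'m" and H :: "real^'n^'r::{finite,linorder}"
  assumes step: "W_step V s1 \<delta>1 W H W' i" and "\<delta>1 > 0"
  defines "D \<equiv> prob_simplex \<inter> sparse_set s1"
  assumes w: "column i W \<in> D"
  shows "column i W' \<in> D"
    and "phi_fun V W W' H i (column i W) - phi_fun V W W' H i (column i W')
      \<ge> \<delta>1 / 2 * (norm (column i W - column i W'))\<^sup>2"
    and "\<exists>\<rho>. 0 \<le> \<rho> \<and> \<rho> \<le> \<delta>1 \<and> proximal_normal D (column i W')
      (\<rho> *\<^sub>R (column i W - column i W')
        - column i ((partial_update W W' i (column i W') ** H - V) ** transpose H))"
proof -
  define \<phi> where "\<phi> = phi_fun V W W' H i"
  define G where "G x = column i ((partial_update W W' i x ** H - V) ** transpose H)" for x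
  define w where "w = column i W"
  define p where "p = column i W'"
  define L where "L = (norm (row i H))\<^sup>2"
  have expand: "\<phi> x = \<phi> y + G y \<bullet> (x - y) + L / 2 * (norm (x - y))\<^sup>2" for x y
    unfolding \<phi>_def G_def L_def by (subst phi_fun_expand[of _ _ _ _ _ x y]) simp
  have G_diff: "G w = G p + L *\<^sub>R (w - p)"
    unfolding G_def L_def by (rule phi_fun_gradient_diff)
  have grad: "gradient \<phi> w = G w"
    by (rule gradient_eqI[where Q = "\<lambda>d. L / 2 * (norm d)\<^sup>2" and K = "L / 2", OF expand])
      (simp add: L_def)
  have goal: "p \<in> D \<and> \<phi> w - \<phi> p \<ge> \<delta>1 / 2 * (norm (w - p))\<^sup>2
    \<and> (\<exists>\<rho>. 0 \<le> \<rho> \<and> \<rho> \<le> \<delta>1 \<and> proximal_normal D p (\<rho> *\<^sub>R (w - p) - G p))"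
  proof (cases "row i H = 0")
    case True
    then have "p = w" using step by (simp add: W_step_def Let_def p_def w_def)
    \<comment> \<open>A zero row of \<open>H\<close> makes the loss independent of this column, so
      the skipped column is already stationary and the zero normal serves.\<close>
    moreover have "G p = 0"
      using True unfolding G_def column_matrix_matrix_mult column_transpose by simp
    ultimately show ?thesis
      using w \<open>\<delta>1 > 0\<close> by (auto simp: w_def proximal_normal_zero intro!: exI[of _ 0])
  next
    case False
    then obtain wb where wb: "is_arg_min \<phi> (\<lambda>x. x \<in> D) wb"
      and alt: "if \<phi> w - \<phi> wb \<ge> \<delta>1 / 2 * (norm (w - wb))\<^sup>2 then p = wb
        else is_projection D (w - (1 / (L + \<delta>1)) *\<^sub>R G w) p"
      using step[unfolded W_step_def Let_def, folded D_def \<phi>_def p_def w_def L_def, unfolded grad]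
      unfolding norm_eq_zero by auto
    show ?thesis
    proof (cases "\<phi> w - \<phi> wb \<ge> \<delta>1 / 2 * (norm (w - wb))\<^sup>2")
      case True
      with alt have p: "p = wb" by simp
      \<comment> \<open>After exact minimization the normal contains no displacement term, so the
        witness is \<open>\<rho> = 0\<close>.\<close>
      have "proximal_normal D p (- G p)"
        by (rule proximal_normal_arg_min[where Q = "\<lambda>d. L / 2 * (norm d)\<^sup>2" and L = L,
              OF wb[folded p] expand]) (simp_all add: L_def)
      then show ?thesis
        using True wb \<open>\<delta>1 > 0\<close> by (auto simp: p is_arg_min_def intro!: exI[of _ 0])
    next
      case False
      with alt have proj: "is_projection D (w - (1 / (L + \<delta>1)) *\<^sub>R G w) p" by simp
      have "L + \<delta>1 > 0" using \<open>\<delta>1 > 0\<close> by (simp add: L_def add_nonneg_pos)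
      have "\<phi> w - \<phi> p \<ge> \<delta>1 / 2 * (norm (w - p))\<^sup>2"
        using w \<open>\<delta>1 > 0\<close>
        by (intro projection_sufficient_decrease[OF proj, where Q = "\<lambda>d. L / 2 * (norm d)\<^sup>2"] expand)
          (auto simp: w_def L_def)
      moreover have "proximal_normal D p ((L + \<delta>1) *\<^sub>R (w - p) - G w)"
        using proximal_normal_gradient_projection[OF proj] \<open>L + \<delta>1 > 0\<close> by simp
      moreover have "(L + \<delta>1) *\<^sub>R (w - p) - G w = \<delta>1 *\<^sub>R (w - p) - G p"
        unfolding G_diff by (simp add: algebra_simps)
      moreover have "p \<in> D" using proj by (simp add: is_projection_def is_arg_min_def)
      ultimately show ?thesis using \<open>\<delta>1 > 0\<close> by (auto intro!: exI[of _ \<delta>1])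
    qed
  qed
  from goal show "column i W' \<in> D"
    and "phi_fun V W W' H i (column i W) - phi_fun V W W' H i (column i W')
      \<ge> \<delta>1 / 2 * (norm (column i W - column i W'))\<^sup>2"
    and "\<exists>\<rho>. 0 \<le> \<rho> \<and> \<rho> \<le> \<delta>1 \<and> proximal_normal D (column i W')
      (\<rho> *\<^sub>R (column i W - column i W')
        - column i ((partial_update W W' i (column i W') ** H - V) ** transpose H))"
    unfolding p_def w_def \<phi>_def G_def by auto
qed

text \<open>The bound on \<open>\<rho>\<close> covers the inverses of both step lengths and depends
  on \<open>W'\<close> only through continuous expressions, so it converges with \<open>W'\<close>.
  The gradient is left at the old \<open>H\<close>.\<close>

lemma H_step_properties:
  fixes W' :: "real^'r^'m" and H H' :: "real^'n^'r"
  assumes step: "H_step V s2 \<delta>2 c W' H H' t" and "\<delta>2 > 0" and "c > 0"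
  defines "D \<equiv> prob_simplex \<inter> sparse_set s2"
  assumes h: "column t H \<in> D"
  shows "column t H' \<in> D"
    and "psi_fun V W' H t (column t H) - psi_fun V W' H t (column t H')
      \<ge> \<delta>2 / 2 * (norm (column t H - column t H'))\<^sup>2"
    and "\<exists>\<rho>. 0 \<le> \<rho> \<and> \<rho> \<le> 1 / c + (norm W')\<^sup>2 + norm (transpose W' ** W') + \<delta>2 \<and>
      proximal_normal D (column t H')
        (\<rho> *\<^sub>R (column t H - column t H') - column t (transpose W' ** (W' ** H - V)))"
proof -
  define \<psi> where "\<psi> = psi_fun V W' H t"
  define g where "g = column t (transpose W' ** (W' ** H - V))"
  define h where "h = column t H"
  define p where "p = column t H'"
  define L where "L = spectral_norm (transpose W' ** W')"
  define \<nu> where "\<nu> = (if norm (W' *v g) = 0 then c else min c ((norm g)\<^sup>2 / (norm (W' *v g))\<^sup>2))"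
  have L: "0 \<le> L" "L \<le> norm (transpose W' ** W')"
    by (simp_all add: L_def spectral_norm_le spectral_norm_nonneg)
  have Q: "1/2 * (norm (W' *v d))\<^sup>2 \<le> L / 2 * (norm d)\<^sup>2" for d
    using norm_matrix_vector_mult_le_spectral[of W' d] by (simp add: L_def)
  have expand: "\<psi> x = \<psi> h + g \<bullet> (x - h) + 1/2 * (norm (W' *v (x - h)))\<^sup>2" for x
    unfolding \<psi>_def g_def h_def by (rule psi_fun_expand)
  have grad: "gradient \<psi> h = g"
    by (rule gradient_eqI[where Q = "\<lambda>d. 1/2 * (norm (W' *v d))\<^sup>2" and K = "L / 2"], rule expand)
      (use Q in simp)
  \<comment> \<open>The step must not degenerate. Either it equals \<open>c\<close>, or it is the
    quotient, whose inverse is controlled by the norm inequality for \<open>W' *v g\<close>.\<close>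
  have \<nu>: "\<nu> > 0" "1 / \<nu> \<le> 1 / c + (norm W')\<^sup>2"
  proof -
    have "\<nu> > 0 \<and> 1 / \<nu> \<le> 1 / c + (norm W')\<^sup>2"
    proof (cases "W' *v g = 0")
      case True
      then show ?thesis using \<open>c > 0\<close> by (simp add: \<nu>_def)
    next
      case False
      then have "g \<noteq> 0" by auto
      have "(norm (W' *v g))\<^sup>2 \<le> (norm W')\<^sup>2 * (norm g)\<^sup>2"
        using norm_matrix_vector_mult_le[of W' g] by (simp add: power_mono power_mult_distrib[symmetric])
      then have "1 / ((norm g)\<^sup>2 / (norm (W' *v g))\<^sup>2) \<le> (norm W')\<^sup>2"
        using \<open>g \<noteq> 0\<close> by (simp add: field_simps)
      moreover have "\<nu> = c \<or> \<nu> = (norm g)\<^sup>2 / (norm (W' *v g))\<^sup>2"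
        using False by (simp add: \<nu>_def min_def)
      moreover have "\<nu> > 0" using False \<open>g \<noteq> 0\<close> \<open>c > 0\<close> by (simp add: \<nu>_def)
      moreover have "1 / c \<ge> 0" using \<open>c > 0\<close> by simp
      ultimately show ?thesis by (smt (verit) zero_le_power2)
    qed
    then show "\<nu> > 0" "1 / \<nu> \<le> 1 / c + (norm W')\<^sup>2" by auto
  qed
  \<comment> \<open>Stated for an arbitrary step \<open>\<tau>\<close> in order to serve both the
    trial step \<open>\<nu>\<close> and the fallback step.\<close>
  have pn: "\<exists>\<rho>. 0 \<le> \<rho> \<and> \<rho> \<le> 1 / c + (norm W')\<^sup>2 + norm (transpose W' ** W') + \<delta>2 \<and>
      proximal_normal D p (\<rho> *\<^sub>R (h - p) - g)"
    if "is_projection D (h - \<tau> *\<^sub>R g) p" "\<tau> > 0" "1 / \<tau> \<le> 1 / c + (norm W')\<^sup>2 + L + \<delta>2" for \<tau>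
    using proximal_normal_gradient_projection[OF that(1,2)] that(2,3) L
    by (intro exI[of _ "1 / \<tau>"]) auto
  obtain hb where hb: "is_projection D (h - \<nu> *\<^sub>R g) hb"
    and alt: "if \<psi> h - \<psi> hb \<ge> \<delta>2 / 2 * (norm (h - hb))\<^sup>2 then p = hb
      else is_projection D (h - (1 / (L + \<delta>2)) *\<^sub>R g) p"
    using step[unfolded H_step_def Let_def, folded D_def \<psi>_def p_def h_def L_def,
        unfolded grad, folded \<nu>_def] by blast
  have goal: "p \<in> D \<and> \<psi> h - \<psi> p \<ge> \<delta>2 / 2 * (norm (h - p))\<^sup>2
    \<and> (\<exists>\<rho>. 0 \<le> \<rho> \<and> \<rho> \<le> 1 / c + (norm W')\<^sup>2 + norm (transpose W' ** W') + \<delta>2 \<and>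
      proximal_normal D p (\<rho> *\<^sub>R (h - p) - g))"
  proof (cases "\<psi> h - \<psi> hb \<ge> \<delta>2 / 2 * (norm (h - hb))\<^sup>2")
    case True
    with alt have p: "p = hb" by simp
    moreover have "p \<in> D" using hb p by (simp add: is_projection_def is_arg_min_def)
    ultimately show ?thesis
      using True pn[of \<nu>] hb \<nu> L \<open>\<delta>2 > 0\<close> by auto
  next
    case False
    with alt have proj: "is_projection D (h - (1 / (L + \<delta>2)) *\<^sub>R g) p" by simp
    have "\<psi> h - \<psi> p \<ge> \<delta>2 / 2 * (norm (h - p))\<^sup>2"
      using assms(5) L \<open>\<delta>2 > 0\<close> Q
      by (intro projection_sufficient_decrease[OF proj, where Q = "\<lambda>d. 1/2 * (norm (W' *v d))\<^sup>2"] expand)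
        (auto simp: h_def)
    moreover have "p \<in> D" using proj by (simp add: is_projection_def is_arg_min_def)
    ultimately show ?thesis
      using pn[OF proj] L \<open>\<delta>2 > 0\<close> \<open>c > 0\<close> by auto
  qed
  from goal show "column t H' \<in> D"
    and "psi_fun V W' H t (column t H) - psi_fun V W' H t (column t H')
      \<ge> \<delta>2 / 2 * (norm (column t H - column t H'))\<^sup>2"
    and "\<exists>\<rho>. 0 \<le> \<rho> \<and> \<rho> \<le> 1 / c + (norm W')\<^sup>2 + norm (transpose W' ** W') + \<delta>2 \<and>
      proximal_normal D (column t H')
        (\<rho> *\<^sub>R (column t H - column t H') - column t (transpose W' ** (W' ** H - V)))"
    unfolding p_def h_def \<psi>_def g_def by auto
qed

section \<open>From decrease in single columns to decrease of the loss\<close>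

text \<open>Indexing by sets of already processed elements turns the sweep into telescoping over
  initial segments. Induction adds a new maximum, which leaves all smaller initial segments
  unchanged.\<close>

lemma sum_telescope_linorder:
  fixes F :: "'i::linorder set \<Rightarrow> real"
  assumes "finite S"
  shows "(\<Sum>i\<in>S. F {l\<in>S. l < i} - F {l\<in>S. l \<le> i}) = F {} - F S"
  using assms
proof (induction S rule: finite_linorder_max_induct)
  case empty
  then show ?case by simp
next
  case (insert b A)
  then have "b \<notin> A" by auto
  have "(\<Sum>i\<in>A. F {l\<in>insert b A. l < i} - F {l\<in>insert b A. l \<le> i})
      = (\<Sum>i\<in>A. F {l\<in>A. l < i} - F {l\<in>A. l \<le> i})"
    using insert(2) by (intro sum.cong arg_cong2[where f = "(-)"] arg_cong[where f = F]) force+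
  moreover have "{l\<in>insert b A. l < b} = A" "{l\<in>insert b A. l \<le> b} = insert b A"
    using insert(2) by auto
  ultimately show ?case using insert.IH insert.hyps(1) \<open>b \<notin> A\<close> by simp
qed

lemma sum_phi_fun_diff:
  fixes W W' :: "real^'r::{finite,linorder}^'m" and H :: "real^'n^'r::{finite,linorder}"
  shows "(\<Sum>i\<in>UNIV. phi_fun V W W' H i (column i W) - phi_fun V W W' H i (column i W'))
    = nmf_loss V W H - nmf_loss V W' H"
proof -
  \<comment> \<open>The loss after exactly the columns in \<open>S\<close> have been replaced; the
    two values of \<open>phi_fun\<close> are those just before and just after column
    \<open>i\<close>.\<close>
  define F where "F S = nmf_loss V (\<chi> a l. if l \<in> S then W' $ a $ l else W $ a $ l) H" for S
  have "phi_fun V W W' H i (column i W) = F {l\<in>UNIV. l < i}"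
    and "phi_fun V W W' H i (column i W') = F {l\<in>UNIV. l \<le> i}" for i
    unfolding phi_fun_def F_def column_def
    by (auto intro!: arg_cong[where f = "\<lambda>A. nmf_loss V A H"] simp: vec_eq_iff)
  then have "(\<Sum>i\<in>UNIV. phi_fun V W W' H i (column i W) - phi_fun V W W' H i (column i W'))
    = F {} - F UNIV" using sum_telescope_linorder[of "UNIV :: 'r set" F] by simp
  then show ?thesis by (simp add: F_def)
qed

text \<open>Each \<open>psi_fun\<close> keeps the other columns at their old values, yet the sum is
  exact: the loss is a sum over the columns of \<open>H\<close>, so these updates do not
  interact.\<close>

lemma sum_psi_fun_diff:
  fixes W :: "real^'r^'m" and H H' :: "real^'n^'r"
  shows "(\<Sum>t\<in>UNIV. psi_fun V W H t (column t H) - psi_fun V W H t (column t H'))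
    = nmf_loss V W H - nmf_loss V W H'"
proof -
  let ?G = "transpose W ** (W ** H - V)"
  have "nmf_loss V W H' = nmf_loss V W H + ?G \<bullet> (H' - H) + 1/2 * (norm (W ** (H' - H)))\<^sup>2"
    using nmf_loss_add_right[of V W H "H' - H"] by simp
  also have "\<dots> = nmf_loss V W H + (\<Sum>t\<in>UNIV. column t ?G \<bullet> (column t H' - column t H)
      + 1/2 * (norm (W *v (column t H' - column t H)))\<^sup>2)"
    by (simp only: inner_eq_sum_columns norm_eq_sum_columns column_matrix_matrix_mult column_diff
        sum.distrib sum_distrib_left add.assoc)
  also have "\<dots> = nmf_loss V W H
      + (\<Sum>t\<in>UNIV. psi_fun V W H t (column t H') - psi_fun V W H t (column t H))"
    by (simp add: psi_fun_expand[of V W H _ "column _ H'"])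
  finally show ?thesis by (simp add: sum_subtractf)
qed

subsection \<open>Convergence of the iteration\<close>

lemma tendsto_zero_of_decrease:
  fixes a d :: "nat \<Rightarrow> real"
  assumes "\<And>k. 0 \<le> a k" and "\<And>k. 0 \<le> d k" and "\<And>k. d k \<le> a k - a (Suc k)"
  shows "d \<longlonglongrightarrow> 0"
proof -
  have "decseq a" by (rule decseq_SucI) (metis assms(2,3) diff_ge_0_iff_ge order_trans)
  then obtain l where l: "a \<longlonglongrightarrow> l" using decseq_convergent[of a 0] assms(1) by blast
  have "(\<lambda>k. a k - a (Suc k)) \<longlonglongrightarrow> l - l"
    by (intro tendsto_diff l LIMSEQ_Suc)
  then show ?thesis
    by (intro tendsto_sandwich[OF _ _ tendsto_const[of 0], of d _ "\<lambda>k. a k - a (Suc k)"])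
      (auto simp: assms)
qed

text \<open>The bound is a convergent sequence rather than a constant, because the multipliers of
  the \<open>H\<close> update are bounded only through the current \<open>W\<close>.\<close>

lemma tendsto_zero_scaleR_bounded:
  fixes x :: "nat \<Rightarrow> 'a::real_normed_vector"
  assumes "x \<longlonglongrightarrow> 0" and "R \<longlonglongrightarrow> r" and "\<And>k. 0 \<le> \<rho> k" and "\<And>k. \<rho> k \<le> R k"
  shows "(\<lambda>k. \<rho> k *\<^sub>R x k) \<longlonglongrightarrow> 0"
proof (rule Lim_null_comparison)
  show "\<forall>\<^sub>F k in sequentially. norm (\<rho> k *\<^sub>R x k) \<le> R k * norm (x k)"
    using assms(3,4) by (simp add: mult_right_mono)
  show "(\<lambda>k. R k * norm (x k)) \<longlonglongrightarrow> 0"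
    using tendsto_mult[OF assms(2) tendsto_norm_zero[OF assms(1)]] by simp
qed

lemma tendsto_columnsI:
  fixes A :: "nat \<Rightarrow> real^'n^'m"
  assumes "\<And>j. (\<lambda>k. column j (A k)) \<longlonglongrightarrow> column j B"
  shows "A \<longlonglongrightarrow> B"
proof (intro vec_tendstoI)
  fix a j
  show "(\<lambda>k. A k $ a $ j) \<longlonglongrightarrow> B $ a $ j"
    using tendsto_vec_nth[OF assms[of j], of a] by (simp add: column_def)
qed

lemma nmf_feasible_Times:
  "nmf_feasible s1 s2 = {A. \<forall>i. column i A \<in> prob_simplex \<inter> sparse_set s1}
    \<times> {B. \<forall>t. column t B \<in> prob_simplex \<inter> sparse_set s2}"
  by (auto simp: nmf_feasible_def)

context
  fixes V :: "real^'n^'m"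
    and W :: "nat \<Rightarrow> real^'r::{finite,linorder}^'m"
    and H :: "nat \<Rightarrow> real^'n^'r::{finite,linorder}"
    and s1 s2 :: nat and \<delta>1 \<delta>2 c :: real
  assumes \<delta>1: "\<delta>1 > 0" and \<delta>2: "\<delta>2 > 0" and c: "c > 0"
    and iteration: "nmf_iteration V s1 s2 \<delta>1 \<delta>2 c W H"
begin

lemma nmf_iteration_steps:
  "W_step V s1 \<delta>1 (W k) (H k) (W (Suc k)) i" "H_step V s2 \<delta>2 c (W (Suc k)) (H k) (H (Suc k)) t"
  using iteration unfolding nmf_iteration_def by auto

lemma nmf_iteration_feasible: "(W k, H k) \<in> nmf_feasible s1 s2"
proof (induction k)
  case 0
  then show ?case using iteration by (simp add: nmf_iteration_def nmf_feasible_def)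
next
  case (Suc k)
  then show ?case
    using W_step_properties(1)[OF nmf_iteration_steps(1) \<delta>1]
      H_step_properties(1)[OF nmf_iteration_steps(2) \<delta>2 c]
    unfolding nmf_feasible_Times mem_Times_iff by auto
qed

lemma nmf_iteration_columns:
  "column i (W k) \<in> prob_simplex \<inter> sparse_set s1" "column t (H k) \<in> prob_simplex \<inter> sparse_set s2"
  using nmf_iteration_feasible[of k] by (auto simp: nmf_feasible_def)

lemmas W_iterate = W_step_properties[OF nmf_iteration_steps(1) \<delta>1 nmf_iteration_columns(1)]
lemmas H_iterate = H_step_properties[OF nmf_iteration_steps(2) \<delta>2 c nmf_iteration_columns(2)]

text \<open>Both sides are sums over columns, so the columnwise decreases add up; the intermediate
  value at the new \<open>W\<close> and the old \<open>H\<close> links the two steps.\<close>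

lemma nmf_iteration_decrease:
  "\<delta>1 / 2 * (norm (W k - W (Suc k)))\<^sup>2 + \<delta>2 / 2 * (norm (H k - H (Suc k)))\<^sup>2
    \<le> nmf_loss V (W k) (H k) - nmf_loss V (W (Suc k)) (H (Suc k))"
proof -
  have "\<delta>1 / 2 * (norm (W k - W (Suc k)))\<^sup>2 \<le> nmf_loss V (W k) (H k) - nmf_loss V (W (Suc k)) (H k)"
    by (simp only: sum_phi_fun_diff[symmetric] norm_eq_sum_columns column_diff sum_distrib_left)
      (rule sum_mono, rule W_iterate(2))
  moreover have "\<delta>2 / 2 * (norm (H k - H (Suc k)))\<^sup>2
      \<le> nmf_loss V (W (Suc k)) (H k) - nmf_loss V (W (Suc k)) (H (Suc k))"
    by (simp only: sum_psi_fun_diff[symmetric] norm_eq_sum_columns column_diff sum_distrib_left)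
      (rule sum_mono, rule H_iterate(2))
  ultimately show ?thesis by linarith
qed

lemma nmf_iteration_diff_tendsto_zero:
  "(\<lambda>k. W k - W (Suc k)) \<longlonglongrightarrow> 0" "(\<lambda>k. H k - H (Suc k)) \<longlonglongrightarrow> 0"
proof -
  have sq: "X \<longlonglongrightarrow> 0" if "(\<lambda>k. e / 2 * (norm (X k))\<^sup>2) \<longlonglongrightarrow> 0" "e > 0"
    for e :: real and X :: "nat \<Rightarrow> 'z::real_normed_vector"
  proof -
    have "(\<lambda>k. 2 / e * (e / 2 * (norm (X k))\<^sup>2)) \<longlonglongrightarrow> 2 / e * 0"
      by (intro tendsto_mult tendsto_const that(1))
    then have "(\<lambda>k. (norm (X k))\<^sup>2) \<longlonglongrightarrow> 0" using that(2) by simp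
    from tendsto_real_sqrt[OF this] show ?thesis by (simp add: tendsto_norm_zero_iff)
  qed
  have nonneg: "0 \<le> nmf_loss V (W k) (H k)" for k by (simp add: nmf_loss_def)
  have pos: "0 \<le> \<delta>1 / 2 * (norm (W k - W (Suc k)))\<^sup>2" "0 \<le> \<delta>2 / 2 * (norm (H k - H (Suc k)))\<^sup>2" for k
    using \<delta>1 \<delta>2 by auto
  have le: "\<delta>1 / 2 * (norm (W k - W (Suc k)))\<^sup>2 \<le> nmf_loss V (W k) (H k) - nmf_loss V (W (Suc k)) (H (Suc k))"
    "\<delta>2 / 2 * (norm (H k - H (Suc k)))\<^sup>2 \<le> nmf_loss V (W k) (H k) - nmf_loss V (W (Suc k)) (H (Suc k))" for k
    using nmf_iteration_decrease[of k] pos[of k] by linarith+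
  show "(\<lambda>k. W k - W (Suc k)) \<longlonglongrightarrow> 0"
    by (rule sq[OF tendsto_zero_of_decrease \<delta>1], rule nonneg, rule pos(1), rule le(1))
  show "(\<lambda>k. H k - H (Suc k)) \<longlonglongrightarrow> 0"
    by (rule sq[OF tendsto_zero_of_decrease \<delta>2], rule nonneg, rule pos(2), rule le(2))
qed

lemma nmf_iteration_critical:
  assumes "accumulation_point (\<lambda>k. (W k, H k)) (Ws, Hs)"
  shows "critical_point (nmf_objective V s1 s2) (Ws, Hs)"
proof -
  define GW where "GW A B = (A ** B - V) ** transpose B" for A :: "real^'r::{finite,linorder}^'m" and B :: "real^'n^'r::{finite,linorder}"
  define GH where "GH A B = transpose A ** (A ** B - V)" for A :: "real^'r::{finite,linorder}^'m" and B :: "real^'n^'r::{finite,linorder}"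
  define F :: "(real^'r::{finite,linorder}^'m) \<times> (real^'n^'r::{finite,linorder}) \<Rightarrow> ereal"
    where "F = nmf_objective V s1 s2"
  define M where "M k i = partial_update (W k) (W (Suc k)) i (column i (W (Suc k)))" for k i
  define R where "R k = 1 / c + (norm (W k))\<^sup>2 + norm (transpose (W k) ** W k) + \<delta>2" for k
  obtain \<sigma> where \<sigma>: "strict_mono \<sigma>" and lim: "(\<lambda>k. (W (\<sigma> k), H (\<sigma> k))) \<longlonglongrightarrow> (Ws, Hs)"
    using assms unfolding accumulation_point_def by (auto simp: o_def)
  have W0: "(\<lambda>k. W (\<sigma> k)) \<longlonglongrightarrow> Ws" and H0: "(\<lambda>k. H (\<sigma> k)) \<longlonglongrightarrow> Hs"
    using tendsto_fst[OF lim] tendsto_snd[OF lim] by simp_all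
  have dW: "(\<lambda>k. W (\<sigma> k) - W (Suc (\<sigma> k))) \<longlonglongrightarrow> 0" and dH: "(\<lambda>k. H (\<sigma> k) - H (Suc (\<sigma> k))) \<longlonglongrightarrow> 0"
    using nmf_iteration_diff_tendsto_zero[THEN LIMSEQ_subseq_LIMSEQ, OF \<sigma>] by (simp_all add: o_def)
  have W1: "(\<lambda>k. W (Suc (\<sigma> k))) \<longlonglongrightarrow> Ws" using tendsto_diff[OF W0 dW] by simp
  have H1: "(\<lambda>k. H (Suc (\<sigma> k))) \<longlonglongrightarrow> Hs" using tendsto_diff[OF H0 dH] by simp
  have transp: "(\<lambda>k. transpose (A k)) \<longlonglongrightarrow> transpose L" if "A \<longlonglongrightarrow> L"
    for A :: "nat \<Rightarrow> real^'x^'y" and L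
    unfolding transpose_def by (intro tendsto_vec_lambda tendsto_vec_nth that)
  have limGW: "(\<lambda>k. GW (A k) (B k)) \<longlonglongrightarrow> GW Ws Hs" if "A \<longlonglongrightarrow> Ws" "B \<longlonglongrightarrow> Hs" for A B
    unfolding GW_def by (intro tendsto_matrix_matrix_mult tendsto_diff tendsto_const transp that)
  have limGH: "(\<lambda>k. GH (A k) (B k)) \<longlonglongrightarrow> GH Ws Hs" if "A \<longlonglongrightarrow> Ws" "B \<longlonglongrightarrow> Hs" for A B
    unfolding GH_def by (intro tendsto_matrix_matrix_mult tendsto_diff tendsto_const transp that)
  \<comment> \<open>Each entry comes from the old or from the new iterate, according to the order of
    the columns, and both converge to \<open>Ws\<close>.\<close>
  have M: "(\<lambda>k. M (\<sigma> k) i) \<longlonglongrightarrow> Ws" for i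
  proof (intro vec_tendstoI)
    fix a l
    show "(\<lambda>k. M (\<sigma> k) i $ a $ l) \<longlonglongrightarrow> Ws $ a $ l"
      using tendsto_vec_nth[OF tendsto_vec_nth[OF W0, of a], of l]
        tendsto_vec_nth[OF tendsto_vec_nth[OF W1, of a], of l]
      by (cases "l < i"; cases "l = i") (simp_all add: M_def partial_update_def column_def)
  qed
  have limR: "(\<lambda>k. R (Suc (\<sigma> k))) \<longlonglongrightarrow> 1 / c + (norm Ws)\<^sup>2 + norm (transpose Ws ** Ws) + \<delta>2"
    unfolding R_def
    by (intro tendsto_add tendsto_const tendsto_power tendsto_norm tendsto_matrix_matrix_mult transp W1)

  have "\<forall>k i. \<exists>\<rho>. 0 \<le> \<rho> \<and> \<rho> \<le> \<delta>1 \<and> proximal_normal (prob_simplex \<inter> sparse_set s1) (column i (W (Suc k)))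
      (\<rho> *\<^sub>R (column i (W k) - column i (W (Suc k))) - column i (GW (M k i) (H k)))"
    unfolding M_def GW_def using W_iterate(3) by blast
  then obtain \<rho> where \<rho>: "\<And>k i. 0 \<le> \<rho> k i" "\<And>k i. \<rho> k i \<le> \<delta>1"
    and pnW: "\<And>k i. proximal_normal (prob_simplex \<inter> sparse_set s1) (column i (W (Suc k)))
      (\<rho> k i *\<^sub>R (column i (W k) - column i (W (Suc k))) - column i (GW (M k i) (H k)))"
    by metis
  \<comment> \<open>The bound is \<open>R (Suc k)\<close> because the \<open>H\<close> update
    already works with the new \<open>W\<close>.\<close>
  have "\<forall>k t. \<exists>\<rho>. 0 \<le> \<rho> \<and> \<rho> \<le> R (Suc k) \<and> proximal_normal (prob_simplex \<inter> sparse_set s2) (column t (H (Suc k)))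
      (\<rho> *\<^sub>R (column t (H k) - column t (H (Suc k))) - column t (GH (W (Suc k)) (H k)))"
    unfolding R_def GH_def using H_iterate(3) by blast
  then obtain \<tau> where \<tau>: "\<And>k t. 0 \<le> \<tau> k t" "\<And>k t. \<tau> k t \<le> R (Suc k)"
    and pnH: "\<And>k t. proximal_normal (prob_simplex \<inter> sparse_set s2) (column t (H (Suc k)))
      (\<tau> k t *\<^sub>R (column t (H k) - column t (H (Suc k))) - column t (GH (W (Suc k)) (H k)))"
    by metis
  \<comment> \<open>The columnwise normals are assembled into one matrix, so that the product
    structure of the feasible set can be used.\<close>
  define NW :: "nat \<Rightarrow> real^'r::{finite,linorder}^'m" where "NW k = (\<chi> a i.
    (\<rho> k i *\<^sub>R (column i (W k) - column i (W (Suc k))) - column i (GW (M k i) (H k))) $ a)" for k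
  define NH :: "nat \<Rightarrow> real^'n^'r::{finite,linorder}" where "NH k = (\<chi> a t.
    (\<tau> k t *\<^sub>R (column t (H k) - column t (H (Suc k))) - column t (GH (W (Suc k)) (H k))) $ a)" for k
  have NW: "column i (NW k) = \<rho> k i *\<^sub>R (column i (W k) - column i (W (Suc k))) - column i (GW (M k i) (H k))" for i k
    unfolding NW_def by (simp add: column_def vec_eq_iff)
  have NH: "column t (NH k) = \<tau> k t *\<^sub>R (column t (H k) - column t (H (Suc k))) - column t (GH (W (Suc k)) (H k))" for t k
    unfolding NH_def by (simp add: column_def vec_eq_iff)
  have col0: "column j (0 :: real^'x^'y) = 0" for j by (simp add: column_def vec_eq_iff)
  have "(NW \<circ> \<sigma>) \<longlonglongrightarrow> - GW Ws Hs"
  proof (rule tendsto_columnsI)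
    fix i
    have "(\<lambda>k. \<rho> (\<sigma> k) i *\<^sub>R column i (W (\<sigma> k) - W (Suc (\<sigma> k)))) \<longlonglongrightarrow> 0"
      using tendsto_column[OF dW, of i] \<rho>
      by (intro tendsto_zero_scaleR_bounded[OF _ tendsto_const[of \<delta>1]]) (simp_all add: col0)
    from tendsto_diff[OF this tendsto_column[OF limGW[OF M H0]]]
    show "(\<lambda>k. column i ((NW \<circ> \<sigma>) k)) \<longlonglongrightarrow> column i (- GW Ws Hs)"
      by (simp add: NW column_diff[symmetric] col0 column_diff[of i 0, simplified])
  qed
  then have limNW: "(\<lambda>k. NW (\<sigma> k)) \<longlonglongrightarrow> - GW Ws Hs" by (simp add: o_def)
  have "(NH \<circ> \<sigma>) \<longlonglongrightarrow> - GH Ws Hs"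
  proof (rule tendsto_columnsI)
    fix t
    have "(\<lambda>k. \<tau> (\<sigma> k) t *\<^sub>R column t (H (\<sigma> k) - H (Suc (\<sigma> k)))) \<longlonglongrightarrow> 0"
      using tendsto_column[OF dH, of t] \<tau>
      by (intro tendsto_zero_scaleR_bounded[OF _ limR]) (simp_all add: col0)
    from tendsto_diff[OF this tendsto_column[OF limGH[OF W1 H0]]]
    show "(\<lambda>k. column t ((NH \<circ> \<sigma>) k)) \<longlonglongrightarrow> column t (- GH Ws Hs)"
      by (simp add: NH column_diff[symmetric] col0 column_diff[of t 0, simplified])
  qed
  then have limNH: "(\<lambda>k. NH (\<sigma> k)) \<longlonglongrightarrow> - GH Ws Hs" by (simp add: o_def)

  \<comment> \<open>The subsequence is shifted by one, since the normals live at the updated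
    columns; the limit is unchanged because displacements vanish.\<close>
  define x where "x k = (W (Suc (\<sigma> k)), H (Suc (\<sigma> k)))" for k
  define s where "s k = (GW (W (Suc (\<sigma> k))) (H (Suc (\<sigma> k))), GH (W (Suc (\<sigma> k))) (H (Suc (\<sigma> k))))
    + (NW (\<sigma> k), NH (\<sigma> k))" for k
  have limx: "x \<longlonglongrightarrow> (Ws, Hs)" unfolding x_def by (intro tendsto_Pair W1 H1)
  have feas: "x k \<in> nmf_feasible s1 s2" for k unfolding x_def by (rule nmf_iteration_feasible)
  then have feas_lim: "(Ws, Hs) \<in> nmf_feasible s1 s2"
    by (intro closed_sequentially[OF closed_nmf_feasible _ limx]) auto
  \<comment> \<open>On feasible points the objective equals the loss, and the limit is feasible too,
    so continuity of the loss gives the convergence of values that the limiting subdifferential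
    demands.\<close>
  have "(\<lambda>k. nmf_loss V (fst (x k)) (snd (x k))) \<longlonglongrightarrow> nmf_loss V Ws Hs"
    unfolding nmf_loss_def x_def fst_conv snd_conv
    by (intro tendsto_mult tendsto_const tendsto_power tendsto_norm tendsto_diff
        tendsto_matrix_matrix_mult W1 H1)
  then have "(\<lambda>k. F (x k)) \<longlonglongrightarrow> F (Ws, Hs)"
    using feas feas_lim by (simp add: F_def nmf_objective_eq)
  moreover have "s k \<in> frechet_subdifferential F (x k)" for k
    unfolding s_def
  proof (rule frechet_subdifferentialI)
    show "GDERIV (\<lambda>z. nmf_loss V (fst z) (snd z)) (x k) :>
        (GW (W (Suc (\<sigma> k))) (H (Suc (\<sigma> k))), GH (W (Suc (\<sigma> k))) (H (Suc (\<sigma> k))))"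
      unfolding x_def GW_def GH_def by (rule GDERIV_nmf_loss)
    show "proximal_normal (nmf_feasible s1 s2) (x k) (NW (\<sigma> k), NH (\<sigma> k))"
      unfolding nmf_feasible_Times x_def
      by (intro proximal_normal_Times proximal_normal_columns) (simp_all only: NW NH pnW pnH)
  qed (auto simp: feas F_def nmf_objective_eq)
  moreover have "s \<longlonglongrightarrow> (GW Ws Hs, GH Ws Hs) + (- GW Ws Hs, - GH Ws Hs)"
    unfolding s_def by (intro tendsto_add tendsto_Pair limGW limGH W1 H1 limNW limNH)
  then have "s \<longlonglongrightarrow> 0" by (simp add: zero_prod_def)
  ultimately show ?thesis
    unfolding critical_point_def limiting_subdifferential_def F_def using limx by blast
qed

end

theorem theorem3p10:
  fixes V :: "real^'n^'m"
    and W :: "nat \<Rightarrow> real^'r::{finite,linorder}^'m"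
    and H :: "nat \<Rightarrow> real^'n^'r::{finite,linorder}"
    and s1 s2 :: nat and \<delta>1 \<delta>2 c :: real
    and Ws :: "real^'r::{finite,linorder}^'m" and Hs :: "real^'n^'r::{finite,linorder}"
  assumes "column_stochastic V"
    and "CARD('r) < min CARD('m) CARD('n)"
    and "s1 > 0" and "s2 > 0"
    and "\<delta>1 > 0" and "\<delta>2 > 0" and "c \<ge> 1 / \<delta>2"
    and "nmf_iteration V s1 s2 \<delta>1 \<delta>2 c W H"
    and "accumulation_point (\<lambda>k. (W k, H k)) (Ws, Hs)"
  shows "critical_point (nmf_objective V s1 s2) (Ws, Hs)"
proof -
  have "c > 0" using assms(6,7) by (smt (verit) zero_less_divide_1_iff)
  then show ?thesis using nmf_iteration_critical assms by blast
qed

end
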